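(* Let $n\ge 4$ be even and $a$ odd with $0<a<a+2<n$. Then $\mathcal{M}_O(n,a,a+2)$ is isomorphic to $\mathrm{HTG}(2,n,a+1)$.
   Context: Subscripts modulo $n$. $\mathcal{M}_O(n,a,b)$ ($a<b$ odd) has vertices $u_0,\dots,u_{n-1},v_0,\dots,v_{n-1}$ and edges $[u_i,u_{i+1}]$ and $[u_i,v_i]$ for all $i$, and $[v_i,v_{i+a}]$, $[v_i,v_{i+b}]$ for all even $i$. For even $0\le\ell<n$, $\mathrm{HTG}(2,n,\ell)$ has vertices $u_0,\dots,u_{n-1},v_0,\dots,v_{n-1}$ and edges $[u_i,u_{i+1}]$, $[v_i,v_{i+1}]$ for all $i$, $[u_i,v_i]$ for odd $i$, and $[u_{i+\ell},v_i]$ for even $i$. *)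

theory Defs
  imports "Graph_Theory.Graph_Theory"
begin

text \<open>
  Undirected graphs are symmetric digraphs without parallel arcs, as usual in the Graph Theory
  library: each definition lists every edge \<open>[x, y]\<close> once, as the arc \<open>(x, y)\<close>, and
  \<^const>\<open>mk_symmetric\<close> adds the reverse arcs.  Subscripts modulo \<open>n\<close> are represented by
  the residues \<open>0, \<dots>, n - 1\<close>; the parity of a subscript is meaningful modulo \<open>n\<close> because
  \<open>n\<close> is always even here.
\<close>

datatype uv_vertex = U_vert nat | V_vert nat

definition uv_vertices :: "nat \<Rightarrow> uv_vertex set" where
  "uv_vertices n = U_vert ` {..<n} \<union> V_vert ` {..<n}"

definition M_O :: "nat \<Rightarrow> nat \<Rightarrow> nat \<Rightarrow> uv_vertex pair_pre_digraph" where
  "M_O n a b = mk_symmetric (with_proj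
     \<lparr> pverts = uv_vertices n,
       parcs = {(U_vert i, U_vert ((i + 1) mod n)) | i. i < n}
             \<union> {(U_vert i, V_vert i) | i. i < n}
             \<union> {(V_vert i, V_vert ((i + a) mod n)) | i. i < n \<and> even i}
             \<union> {(V_vert i, V_vert ((i + b) mod n)) | i. i < n \<and> even i} \<rparr>)"

text \<open>The honeycomb toroidal graph \<open>HTG(2, n, l)\<close>.\<close>

definition HTG2 :: "nat \<Rightarrow> nat \<Rightarrow> uv_vertex pair_pre_digraph" where
  "HTG2 n l = mk_symmetric (with_proj
     \<lparr> pverts = uv_vertices n,
       parcs = {(U_vert i, U_vert ((i + 1) mod n)) | i. i < n}
             \<union> {(V_vert i, V_vert ((i + 1) mod n)) | i. i < n}
             \<union> {(U_vert i, V_vert i) | i. i < n \<and> odd i}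
             \<union> {(U_vert ((i + l) mod n), V_vert i) | i. i < n \<and> even i} \<rparr>)"

lemma add_mod_neq_self:
  fixes i k n :: nat
  assumes "0 < k" "k < n" "i < n"
  shows "(i + k) mod n \<noteq> i"
  using assms by (cases "i + k < n") (auto simp: mod_if)

lemma parcs_mk_symmetric:
  "parcs (mk_symmetric (with_proj G)) = parcs G \<union> (parcs G)\<inverse>"
  by (force simp: mk_symmetric_def)

lemma pair_graph_mk_symmetric:
  assumes "finite (pverts G)" "parcs G \<subseteq> pverts G \<times> pverts G"
    and "\<And>x. (x, x) \<notin> parcs G"
  shows "pair_graph (mk_symmetric (with_proj G))"
proof -
  have sub: "parcs (mk_symmetric (with_proj G)) \<subseteq> pverts G \<times> pverts G"
    using assms(2) by (auto simp: parcs_mk_symmetric)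
  then have fin: "finite (parcs (mk_symmetric (with_proj G)))"
    using assms(1) finite_subset by blast
  show ?thesis
  proof
    show "symmetric (with_proj (mk_symmetric (with_proj G)))"
      by (auto simp: symmetric_def parcs_mk_symmetric sym_def)
  qed (use assms sub fin in \<open>auto simp: mk_symmetric_def\<close>)
qed

lemma pair_graph_M_O:
  assumes "2 \<le> n" "0 < a" "a < b" "b < n"
  shows "pair_graph (M_O n a b)"
  unfolding M_O_def
  by (rule pair_graph_mk_symmetric)
    (use assms add_mod_neq_self[of 1 n] add_mod_neq_self[of a n] add_mod_neq_self[of b n] in
      \<open>force simp: uv_vertices_def\<close>)+

lemma pair_graph_HTG2:
  assumes "2 \<le> n"
  shows "pair_graph (HTG2 n l)"
  unfolding HTG2_def
  by (rule pair_graph_mk_symmetric)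
    (use assms add_mod_neq_self[of 1 n] in \<open>force simp: uv_vertices_def\<close>)+

end

theory Submission
  imports Defs
begin

text \<open>
  The arcs \<open>[v\<^sub>i, v\<^bsub>i+a\<^esub>]\<close> and \<open>[v\<^sub>i, v\<^bsub>i+a+2\<^esub>]\<close> form the single \<open>n\<close>-cycle
  \<open>v\<^sub>0, v\<^bsub>a+2\<^esub>, v\<^sub>2, v\<^bsub>a+4\<^esub>, v\<^sub>4, \<dots>\<close>, whose \<open>j\<close>-th vertex is \<open>v\<^sub>j\<close> for even \<open>j\<close> and
  \<open>v\<^bsub>j+a+1\<^esub>\<close> for odd \<open>j\<close>.  Numbering the \<open>v\<close>-vertices along this cycle leaves the spokes at
  even positions straight and twists those at odd positions by \<open>a + 1\<close>; in the honeycomb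
  toroidal graph the parities are exchanged, so all positions are also shifted by one.
\<close>

text \<open>Arcs of a pair digraph are pairs of vertices, so the vertex map forces the arc map
  \<open>map_prod f f\<close>. An inverse that also preserves arcs makes this map surjective on
  arcs, so no arcs need counting.\<close>

lemma digraph_iso_with_projI:
  assumes "pair_wf_digraph G" and "pair_wf_digraph H"
    and f: "f ` pverts G \<subseteq> pverts H" and g: "g ` pverts H \<subseteq> pverts G"
    and gf: "\<And>x. x \<in> pverts G \<Longrightarrow> g (f x) = x"
    and fg: "\<And>y. y \<in> pverts H \<Longrightarrow> f (g y) = y"
    and arcs_f: "\<And>x y. (x, y) \<in> parcs G \<Longrightarrow> (f x, f y) \<in> parcs H"
    and arcs_g: "\<And>x y. (x, y) \<in> parcs H \<Longrightarrow> (g x, g y) \<in> parcs G"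
  shows "digraph_iso (with_proj G) (with_proj H)"
proof -
  interpret G: pair_wf_digraph G by fact
  interpret H: pair_wf_digraph H by fact
  let ?h = "\<lparr>iso_verts = f, iso_arcs = map_prod f f, iso_head = snd, iso_tail = fst\<rparr>"
  have inj: "inj_on f (pverts G)"
    using gf by (rule inj_on_inverseI)
  have "inj_on (map_prod f f) (parcs G)"
    by (rule inj_on_subset[OF map_prod_inj_on[OF inj inj]]) (auto dest: G.in_arcsD1 G.in_arcsD2)
  then have "pre_digraph.digraph_isomorphism (with_proj G) ?h"
    using inj G.wf_digraph by (simp add: pre_digraph.digraph_isomorphism_def)
  moreover have "f ` pverts G = pverts H"
    using f g fg by (metis image_subset_iff rev_image_eqI subsetI subset_antisym)
  moreover have "map_prod f f ` parcs G = parcs H"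
  proof
    show "parcs H \<subseteq> map_prod f f ` parcs G"
    proof clarify
      fix x y assume xy: "(x, y) \<in> parcs H"
      then have "(x, y) = map_prod f f (g x, g y)"
        using fg H.in_arcsD1 H.in_arcsD2 by simp
      then show "(x, y) \<in> map_prod f f ` parcs G"
        using arcs_g[OF xy] by blast
    qed
  qed (use arcs_f in auto)
  ultimately show ?thesis
    unfolding digraph_iso_def
    by (intro exI[of _ ?h]) (simp add: app_iso_def with_proj_def)
qed

text \<open>Applying \<open>h\<close> to both ends commutes with reversing an arc, so only the
  listed orientation of each edge has to be checked.\<close>

lemma parcs_mk_symmetric_map:
  assumes "\<And>x y. (x, y) \<in> parcs G \<Longrightarrow> (h x, h y) \<in> parcs (mk_symmetric (with_proj H))"
    and "(x, y) \<in> parcs (mk_symmetric (with_proj G))"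
  shows "(h x, h y) \<in> parcs (mk_symmetric (with_proj H))"
  using assms by (auto simp: Defs.parcs_mk_symmetric)

lemma sym_parcs_mk_symmetric:
  "(x, y) \<in> parcs (mk_symmetric (with_proj G)) \<Longrightarrow> (y, x) \<in> parcs (mk_symmetric (with_proj G))"
  by (auto simp: Defs.parcs_mk_symmetric)

lemma even_mod_even_iff: "even n \<Longrightarrow> even (x mod n) = even x" for x n :: nat
  by (simp add: dvd_mod_iff)

text \<open>The index \<open>x\<close> need not be below \<open>n\<close>, so shifted indices such
  as \<open>i + (n - 1)\<close> can be plugged in directly; parity survives reduction because
  \<open>n\<close> is even.\<close>

lemma
  assumes "0 < n" "even n"
  shows M_O_arc_U: "(U_vert (x mod n), U_vert ((x + 1) mod n)) \<in> parcs (M_O n a b)"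
    and M_O_arc_UV: "(U_vert (x mod n), V_vert (x mod n)) \<in> parcs (M_O n a b)"
    and M_O_arc_V1: "even x \<Longrightarrow> (V_vert (x mod n), V_vert ((x + a) mod n)) \<in> parcs (M_O n a b)"
    and M_O_arc_V2: "even x \<Longrightarrow> (V_vert (x mod n), V_vert ((x + b) mod n)) \<in> parcs (M_O n a b)"
  using assms even_mod_even_iff[of n x] mod_less_divisor[of n x]
  unfolding M_O_def Defs.parcs_mk_symmetric
  by simp_all (metis mod_Suc_eq mod_add_left_eq)+

lemma
  assumes "0 < n" "even n"
  shows HTG2_arc_U: "(U_vert (x mod n), U_vert ((x + 1) mod n)) \<in> parcs (HTG2 n l)"
    and HTG2_arc_V: "(V_vert (x mod n), V_vert ((x + 1) mod n)) \<in> parcs (HTG2 n l)"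
    and HTG2_arc_UV_odd: "odd x \<Longrightarrow> (U_vert (x mod n), V_vert (x mod n)) \<in> parcs (HTG2 n l)"
    and HTG2_arc_UV_even:
      "even x \<Longrightarrow> (U_vert ((x + l) mod n), V_vert (x mod n)) \<in> parcs (HTG2 n l)"
  using assms even_mod_even_iff[of n x] mod_less_divisor[of n x]
  unfolding HTG2_def Defs.parcs_mk_symmetric
  by simp_all (metis mod_Suc_eq mod_add_left_eq)+

text \<open>For odd \<open>i\<close>, the cycle position of \<open>V_vert i\<close> is i - (a + 1);
  shifted by one it becomes i - a, written \<open>i + (n - a)\<close> to avoid truncated
  subtraction.\<close>

fun M_O_to_HTG2 :: "nat \<Rightarrow> nat \<Rightarrow> uv_vertex \<Rightarrow> uv_vertex" where
  "M_O_to_HTG2 n a (U_vert i) = U_vert ((i + 1) mod n)"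
| "M_O_to_HTG2 n a (V_vert i) = V_vert ((if even i then i + 1 else i + (n - a)) mod n)"

text \<open>The parity test is opposite to the one in \<open>M_O_to_HTG2\<close>, which flips the
  parity of every index: both 1 and \<open>n - a\<close> are odd.\<close>

fun HTG2_to_M_O :: "nat \<Rightarrow> nat \<Rightarrow> uv_vertex \<Rightarrow> uv_vertex" where
  "HTG2_to_M_O n a (U_vert i) = U_vert ((i + (n - 1)) mod n)"
| "HTG2_to_M_O n a (V_vert i) = V_vert ((if odd i then i + (n - 1) else i + a) mod n)"

lemma mod_add_diff_mod:
  fixes i k n :: nat
  assumes "k \<le> n"
  shows "((i + k) mod n + (n - k)) mod n = i mod n"
    and "((i + (n - k)) mod n + k) mod n = i mod n"
  using assms unfolding mod_add_left_eq by simp_all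

lemma M_O_to_HTG2_arc:
  assumes "0 < n" "even n" "odd a" "a < n" and "(x, y) \<in> parcs (M_O n a (a + 2))"
  shows "(M_O_to_HTG2 n a x, M_O_to_HTG2 n a y) \<in> parcs (HTG2 n (a + 1))"
proof -
  let ?f = "M_O_to_HTG2 n a" and ?H = "parcs (HTG2 n (a + 1))"
  note n = assms(1,2)
  have H_sym: "(v, w) \<in> ?H \<Longrightarrow> (w, v) \<in> ?H" for v w
    unfolding HTG2_def by (rule sym_parcs_mk_symmetric)
  have U: "(?f (U_vert i), ?f (U_vert ((i + 1) mod n))) \<in> ?H" for i
    using HTG2_arc_U[OF n, of "i + 1"] by (simp add: mod_simps)
  have UV: "(?f (U_vert i), ?f (V_vert i)) \<in> ?H" for i
  proof (cases "even i")
    case True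
    then show ?thesis
      using HTG2_arc_UV_odd[OF n, of "i + 1"] by simp
  next
    case False
    \<comment> \<open>The image of \<open>V_vert i\<close> has an even index, and its twisted spoke
      must end at the image of \<open>U_vert i\<close>.\<close>
    have "i + (n - a) + (a + 1) = i + 1 + n"
      using assms(4) by simp
    then have "(i + (n - a) + (a + 1)) mod n = (i + 1) mod n"
      by (metis mod_add_self2)
    then show ?thesis
      using False assms HTG2_arc_UV_even[OF n, of "i + (n - a)" "a + 1"] by simp
  qed
  have V1: "(?f (V_vert i), ?f (V_vert ((i + a) mod n))) \<in> ?H" if "even i" for i
  proof -
    \<comment> \<open>The ends go to positions i + 1 and i, so the cycle is traversed backwards here
      and \<open>H_sym\<close> is needed.\<close>
    have "?f (V_vert ((i + a) mod n)) = V_vert (i mod n)"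
      using that assms mod_add_diff_mod(1)[of a n i] by (simp add: even_mod_even_iff)
    then show ?thesis
      using that H_sym[OF HTG2_arc_V[OF n, of i]] by simp
  qed
  have V2: "(?f (V_vert i), ?f (V_vert ((i + (a + 2)) mod n))) \<in> ?H" if "even i" for i
  proof -
    \<comment> \<open>This chord goes from position i + 1 forward to i + 2.\<close>
    have "((i + (a + 2)) mod n + (n - a)) mod n = (i + 2) mod n"
      using mod_add_diff_mod(1)[of a n "i + 2"] assms by (simp add: add_ac)
    then have "?f (V_vert ((i + (a + 2)) mod n)) = V_vert ((i + 1 + 1) mod n)"
      using that assms by (simp add: even_mod_even_iff)
    then show ?thesis
      using that HTG2_arc_V[OF n, of "i + 1"] by simp
  qed
  show ?thesis
    unfolding HTG2_def
    by (rule parcs_mk_symmetric_map[OF _ assms(5)[unfolded M_O_def]], fold HTG2_def)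
      (use U UV V1 V2 in \<open>auto simp del: M_O_to_HTG2.simps\<close>)
qed

lemma HTG2_to_M_O_arc:
  assumes "0 < n" "even n" "odd a" "a < n" and "(x, y) \<in> parcs (HTG2 n (a + 1))"
  shows "(HTG2_to_M_O n a x, HTG2_to_M_O n a y) \<in> parcs (M_O n a (a + 2))"
proof -
  let ?g = "HTG2_to_M_O n a" and ?M = "parcs (M_O n a (a + 2))"
  note n = assms(1,2)
  have M_sym: "(v, w) \<in> ?M \<Longrightarrow> (w, v) \<in> ?M" for v w
    unfolding M_O_def by (rule sym_parcs_mk_symmetric)
  have pred: "((i + 1) mod n + (n - 1)) mod n = i mod n" "(i + (n - 1) + 1) mod n = i mod n" for i
    using mod_add_diff_mod[of 1 n i] n by (simp_all add: mod_simps)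
  have U: "(?g (U_vert i), ?g (U_vert ((i + 1) mod n))) \<in> ?M" for i
    using M_O_arc_U[OF n, of "i + (n - 1)"] by (simp only: pred HTG2_to_M_O.simps)
  have V: "(?g (V_vert i), ?g (V_vert ((i + 1) mod n))) \<in> ?M" for i
  proof (cases "even i")
    case True
    then have "?g (V_vert ((i + 1) mod n)) = V_vert (i mod n)"
      using assms pred(1)[of i] by (simp add: even_mod_even_iff)
    then show ?thesis
      using True M_sym[OF M_O_arc_V1[OF n, of i]] by simp
  next
    case False
    \<comment> \<open>For odd \<open>i\<close> the ends go to i - 1, which is even, and i + 1 + a;
      they differ by a + 2, so this is a long chord.\<close>
    have "(i + (n - 1) + (a + 2)) mod n = (i + 1 + a + n) mod n"
      using n by (intro arg_cong[where f = "\<lambda>k. k mod n"]) simp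
    also have "\<dots> = ((i + 1) mod n + a) mod n"
      by (simp only: mod_add_self2 mod_add_left_eq)
    finally have "?g (V_vert ((i + 1) mod n)) = V_vert ((i + (n - 1) + (a + 2)) mod n)"
      using False assms by (simp add: even_mod_even_iff)
    moreover have "?g (V_vert i) = V_vert ((i + (n - 1)) mod n)"
      using False by simp
    moreover have "even (i + (n - 1))"
      using False n by simp
    ultimately show ?thesis
      using M_O_arc_V2[OF n, of "i + (n - 1)" "a + 2" a] by (simp only:)
  qed
  have UV_odd: "(?g (U_vert i), ?g (V_vert i)) \<in> ?M" if "odd i" for i
    using that M_O_arc_UV[OF n, of "i + (n - 1)"] by simp
  \<comment> \<open>Both ends land on index i + a: \<open>U_vert\<close> steps back by one from i +
    a + 1, while \<open>V_vert\<close> moves up by \<open>a\<close>.\<close>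
  have UV_even: "(?g (U_vert ((i + (a + 1)) mod n)), ?g (V_vert i)) \<in> ?M" if "even i" for i
    using that M_O_arc_UV[OF n, of "i + a"] pred(1)[of "i + a"] by (simp add: add_ac)
  show ?thesis
    unfolding M_O_def
    by (rule parcs_mk_symmetric_map[OF _ assms(5)[unfolded HTG2_def]], fold M_O_def)
      (use U V UV_odd UV_even in \<open>auto simp del: HTG2_to_M_O.simps\<close>)
qed

theorem theorem5p1:
  fixes n a :: nat
  assumes "n \<ge> 4" and "even n"
    and "odd a" and "0 < a" and "a + 2 < n"
  shows "digraph_iso (with_proj (M_O n a (a + 2))) (with_proj (HTG2 n (a + 1)))"
proof -
  interpret M: pair_graph "M_O n a (a + 2)"
    using assms by (intro pair_graph_M_O) auto
  interpret H: pair_graph "HTG2 n (a + 1)"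
    using assms by (intro pair_graph_HTG2) auto
  have verts: "pverts (M_O n a (a + 2)) = uv_vertices n" "pverts (HTG2 n (a + 1)) = uv_vertices n"
    by (simp_all add: M_O_def HTG2_def)
  have n: "0 < n" "a < n"
    using assms by auto
  show ?thesis
  proof (rule digraph_iso_with_projI[where f = "M_O_to_HTG2 n a" and g = "HTG2_to_M_O n a"])
    show "M_O_to_HTG2 n a ` pverts (M_O n a (a + 2)) \<subseteq> pverts (HTG2 n (a + 1))"
      and "HTG2_to_M_O n a ` pverts (HTG2 n (a + 1)) \<subseteq> pverts (M_O n a (a + 2))"
      using n unfolding verts by (auto simp: uv_vertices_def)
    show "HTG2_to_M_O n a (M_O_to_HTG2 n a x) = x" if "x \<in> pverts (M_O n a (a + 2))" for x
      using that assms n unfolding verts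
      by (auto simp: uv_vertices_def even_mod_even_iff mod_add_diff_mod
          simp del: One_nat_def Nat.add_diff_assoc)
    show "M_O_to_HTG2 n a (HTG2_to_M_O n a y) = y" if "y \<in> pverts (HTG2 n (a + 1))" for y
      using that assms n unfolding verts
      by (auto simp: uv_vertices_def even_mod_even_iff mod_add_diff_mod
          simp del: One_nat_def Nat.add_diff_assoc)
  qed (use assms n M.pair_wf_digraph_axioms H.pair_wf_digraph_axioms M_O_to_HTG2_arc
      HTG2_to_M_O_arc in auto)
qed

end
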